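(* For every $A>0$, the function $m$ is a symmetric metric on $\mathfrak{T}_A$, the set of equivalence classes of labeled triangles of area $A$.
   Context: A labeled triangle $T$ is a (non-degenerate) triangle in the Euclidean plane whose vertices are labeled $v_1,v_2,v_3$ so that the labeling induces the counter-clockwise orientation on the boundary. The edge opposite $v_i$ is $e_i$, with length $\|e_i\|$; the altitude from $v_i$ is $h_i$, with length $\|h_i\|$. Primed symbols denote the corresponding objects for $T'$. Define $$m(T,T')=\log\Big(\max\Big\{\tfrac{\|e_1'\|}{\|e_1\|},\tfrac{\|e_2'\|}{\|e_2\|},\tfrac{\|e_3'\|}{\|e_3\|},\tfrac{\|h_1'\|}{\|h_1\|},\tfrac{\|h_2'\|}{\|h_2\|},\tfrac{\|h_3'\|}{\|h_3\|}\Big\}\Big).$$ For $A>0$, $\mathfrak{T}_A$ is the set of equivalence classes of labeled triangles with area $A$, where two labeled triangles are equivalent if there is an isometry between them respecting the labeling. $m$ descends to a function on $\mathfrak{T}_A\times\mathfrak{T}_A$, also denoted $m$. Convention: a metric on a set $X$ is a function $\eta:X\times X\to\mathbb{R}$ such that $\eta(x,x)=0$ for all $x$, $\eta(x,y)>0$ if $x\neq y$, and $\eta(x,y)+\eta(y,z)\ge\eta(x,z)$ for all $x,y,z$. It is symmetric if $\eta(x,y)=\eta(y,x)$ for all $x,y$. *)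

theory Defs
  imports "HOL-Analysis.Analysis"
begin

(* The library's Metric_space locale demands symmetry and nonnegativity on the whole type,
   so the possibly asymmetric notion is defined here, relative to a carrier. *)
definition metric_on :: "'a set \<Rightarrow> ('a \<Rightarrow> 'a \<Rightarrow> real) \<Rightarrow> bool" where
  "metric_on X \<eta> \<longleftrightarrow>
     (\<forall>x\<in>X. \<eta> x x = 0) \<and>
     (\<forall>x\<in>X. \<forall>y\<in>X. x \<noteq> y \<longrightarrow> \<eta> x y > 0) \<and>
     (\<forall>x\<in>X. \<forall>y\<in>X. \<forall>z\<in>X. \<eta> x y + \<eta> y z \<ge> \<eta> x z)"

definition symmetric_on :: "'a set \<Rightarrow> ('a \<Rightarrow> 'a \<Rightarrow> real) \<Rightarrow> bool" where
  "symmetric_on X \<eta> \<longleftrightarrow> (\<forall>x\<in>X. \<forall>y\<in>X. \<eta> x y = \<eta> y x)"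

(* A triple of points of the plane. Arithmetic in the index type 3 is modulo 3 (and 3 = 0),
   so i + 1 and i + 2 are the two indices other than i. *)
type_synonym triple = "3 \<Rightarrow> real^2"

definition triangle_hull :: "triple \<Rightarrow> (real^2) set" where
  "triangle_hull T = convex hull {T 1, T 2, T 3}"

definition counterclockwise :: "triple \<Rightarrow> bool" where
  "counterclockwise T \<longleftrightarrow> det (vector [T 2 - T 1, T 3 - T 1] :: real^2^2) > 0"

definition labeled_triangle :: "triple \<Rightarrow> bool" where
  "labeled_triangle T \<longleftrightarrow> \<not> collinear {T 1, T 2, T 3} \<and> counterclockwise T"

definition area :: "triple \<Rightarrow> real" where
  "area T = measure lborel (triangle_hull T)"

definition edge_length :: "triple \<Rightarrow> 3 \<Rightarrow> real" where
  "edge_length T i = dist (T (i + 1)) (T (i + 2))"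

(* Distance to the line spanned by the opposite edge: the foot of the altitude
   need not lie on the edge itself. *)
definition altitude_length :: "triple \<Rightarrow> 3 \<Rightarrow> real" where
  "altitude_length T i = infdist (T i) (affine hull {T (i + 1), T (i + 2)})"

definition m :: "triple \<Rightarrow> triple \<Rightarrow> real" where
  "m T T' = ln (Max {edge_length T' 1 / edge_length T 1,
                     edge_length T' 2 / edge_length T 2,
                     edge_length T' 3 / edge_length T 3,
                     altitude_length T' 1 / altitude_length T 1,
                     altitude_length T' 2 / altitude_length T 2,
                     altitude_length T' 3 / altitude_length T 3})"

definition label_isometric :: "triple \<Rightarrow> triple \<Rightarrow> bool" where
  "label_isometric T T' \<longleftrightarrow>
     (\<exists>f. f ` triangle_hull T = triangle_hull T' \<and>
          (\<forall>x\<in>triangle_hull T. \<forall>y\<in>triangle_hull T. dist (f x) (f y) = dist x y) \<and>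
          (\<forall>i. f (T i) = T' i))"

definition triangles_of_area :: "real \<Rightarrow> triple set" where
  "triangles_of_area A = {T. labeled_triangle T \<and> area T = A}"

definition triangle_equiv :: "real \<Rightarrow> (triple \<times> triple) set" where
  "triangle_equiv A =
     {(T, T'). T \<in> triangles_of_area A \<and> T' \<in> triangles_of_area A \<and> label_isometric T T'}"

definition triangle_space :: "real \<Rightarrow> triple set set" where
  "triangle_space A = triangles_of_area A // triangle_equiv A"

(* The common value of m on all pairs of representatives; the_elem is unspecified
   on non-singletons, so this is meaningful exactly because m respects the equivalence. *)
definition m_class :: "triple set \<Rightarrow> triple set \<Rightarrow> real" where
  "m_class X Y = the_elem ((\<lambda>(T, T'). m T T') ` (X \<times> Y))"

lemma triangle_vertex_in_hull: "T i \<in> triangle_hull T"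
proof -
  have "T i \<in> {T 1, T 2, T 3}"
    using exhaust_3[of i] by auto
  then show ?thesis
    unfolding triangle_hull_def by (rule hull_inc)
qed

lemma label_isometric_refl: "label_isometric T T"
  unfolding label_isometric_def by (rule exI[of _ id]) auto

lemma label_isometric_sym:
  assumes "label_isometric T T'"
  shows "label_isometric T' T"
proof -
  let ?S = "triangle_hull T" and ?S' = "triangle_hull T'"
  obtain f where im: "f ` ?S = ?S'"
    and d: "\<And>x y. x \<in> ?S \<Longrightarrow> y \<in> ?S \<Longrightarrow> dist (f x) (f y) = dist x y"
    and v: "\<And>i. f (T i) = T' i"
    using assms unfolding label_isometric_def by blast
  have inj: "inj_on f ?S"
    using d by (metis dist_eq_0_iff inj_onI)
  let ?g = "inv_into ?S f"
  have "?g ` ?S' = ?S"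
    using im inj by (metis inv_into_image_cancel order_refl)
  moreover have "dist (?g x) (?g y) = dist x y" if "x \<in> ?S'" "y \<in> ?S'" for x y
    using that d[of "?g x" "?g y"] im by (simp add: f_inv_into_f inv_into_into)
  moreover have "?g (T' i) = T i" for i
    using inv_into_f_f[OF inj triangle_vertex_in_hull] v by metis
  ultimately show ?thesis
    unfolding label_isometric_def by blast
qed

lemma label_isometric_trans:
  assumes "label_isometric T T'" "label_isometric T' T''"
  shows "label_isometric T T''"
proof -
  obtain f g where fg: "f ` triangle_hull T = triangle_hull T'"
    "\<forall>x\<in>triangle_hull T. \<forall>y\<in>triangle_hull T. dist (f x) (f y) = dist x y"
    "\<forall>i. f (T i) = T' i"
    "g ` triangle_hull T' = triangle_hull T''"
    "\<forall>x\<in>triangle_hull T'. \<forall>y\<in>triangle_hull T'. dist (g x) (g y) = dist x y"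
    "\<forall>i. g (T' i) = T'' i"
    using assms unfolding label_isometric_def by blast
  show ?thesis
    unfolding label_isometric_def
  proof (intro exI[of _ "g \<circ> f"] conjI)
    show "(g \<circ> f) ` triangle_hull T = triangle_hull T''"
      using fg(1,4) by (metis image_comp)
    show "\<forall>x\<in>triangle_hull T. \<forall>y\<in>triangle_hull T. dist ((g \<circ> f) x) ((g \<circ> f) y) = dist x y"
      using fg(1,2,5) by (metis comp_apply imageI)
    show "\<forall>i. (g \<circ> f) (T i) = T'' i"
      using fg(3,6) by simp
  qed
qed

lemma equiv_triangle_equiv: "equiv (triangles_of_area A) (triangle_equiv A)"
proof (rule equivI)
  show "triangle_equiv A \<subseteq> triangles_of_area A \<times> triangles_of_area A"
    unfolding triangle_equiv_def by auto
  show "refl_on (triangles_of_area A) (triangle_equiv A)"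
    unfolding refl_on_def triangle_equiv_def using label_isometric_refl by auto
  show "sym (triangle_equiv A)"
    unfolding sym_def triangle_equiv_def using label_isometric_sym by auto
  show "trans (triangle_equiv A)"
    unfolding trans_def triangle_equiv_def using label_isometric_trans by blast
qed

end

theory Submission
  imports Defs
begin

text \<open>Edge times altitude is twice the area (\<open>edge_length_mult_altitude_length\<close>),
  so for triangles of equal positive area each altitude ratio is the inverse of the corresponding
  edge ratio. The logarithm of the maximum is therefore the largest absolute difference between the
  logarithms of corresponding edge lengths (\<open>m_le_iff\<close>): \<open>m\<close> is the
  pullback of the sup metric under the map sending a triangle to its three log edge lengths.
  Symmetry and the triangle inequality are inherited from the sup metric. Isometric triangles have
  equal edge lengths, so \<open>m\<close> descends to classes (\<open>m_class_eq\<close>);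
  conversely, edge lengths determine the class by side-side-side congruence
  (\<open>edge_length_eq_imp_label_isometric\<close>), which gives positivity between distinct
  classes.\<close>

definition cross2 :: "real^2 \<Rightarrow> real^2 \<Rightarrow> real" where
  "cross2 u v = u$1 * v$2 - u$2 * v$1"

lemma cross2_simps [simp]:
  "cross2 (u + v) w = cross2 u w + cross2 v w"
  "cross2 w (u + v) = cross2 w u + cross2 w v"
  "cross2 (c *\<^sub>R u) w = c * cross2 u w"
  "cross2 w (c *\<^sub>R u) = c * cross2 w u"
  "cross2 u u = 0"
  by (simp_all add: cross2_def algebra_simps)

lemma lagrange_identity_2: "(norm u * norm v)\<^sup>2 = (cross2 u v)\<^sup>2 + (u \<bullet> v)\<^sup>2"
  for u v :: "real^2"
  unfolding power_mult_distrib power2_norm_eq_inner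
  by (simp add: cross2_def inner_vec_def sum_2 algebra_simps power2_eq_square)

lemma content_triangle_cross2:
  "2 * measure lborel (convex hull {a, b, c}) = \<bar>cross2 (b - a) (c - a)\<bar>"
  by (simp add: content_triangle cross2_def algebra_simps abs_if)

text \<open>Base times height: both sides are the area of the parallelogram spanned by
  \<open>b - a\<close> and \<open>c - a\<close>. If \<open>a = b\<close>, both vanish.\<close>

lemma dist_mult_infdist_affine_hull:
  fixes a b c :: "real^2"
  shows "dist a b * infdist c (affine hull {a, b}) = \<bar>cross2 (b - a) (c - a)\<bar>"
proof (cases "a = b")
  case True
  then show ?thesis by (simp add: cross2_def)
next
  case False
  let ?u = "b - a" and ?w = "c - a"
  have hull: "affine hull {a, b} = range (\<lambda>t. a + t *\<^sub>R ?u)"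
    by (auto simp: affine_hull_2_alt)
  \<comment> \<open>Lagrange's identity for \<open>?u\<close> and the vector from a point of the
    line to \<open>c\<close>: moving along the line leaves the cross product unchanged, so only the
    second square depends on \<open>t\<close>.\<close>
  have key: "(norm ?u * dist c (a + t *\<^sub>R ?u))\<^sup>2
      = (cross2 ?u ?w)\<^sup>2 + (?u \<bullet> ?w - t * (?u \<bullet> ?u))\<^sup>2" for t
  proof -
    have "c - (a + t *\<^sub>R ?u) = ?w + (- t) *\<^sub>R ?u" by simp
    then show ?thesis
      unfolding dist_norm by (simp only: lagrange_identity_2 cross2_simps inner_simps) simp
  qed
  have pos: "norm ?u > 0" "?u \<bullet> ?u \<noteq> 0" using False by auto
  have "infdist c (affine hull {a, b}) = \<bar>cross2 ?u ?w\<bar> / norm ?u"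
  proof (rule antisym)
    \<comment> \<open>The parameter of the foot of the perpendicular, where the second square in
      \<open>key\<close> vanishes.\<close>
    let ?t = "(?u \<bullet> ?w) / (?u \<bullet> ?u)"
    have "(norm ?u * dist c (a + ?t *\<^sub>R ?u))\<^sup>2 = \<bar>cross2 ?u ?w\<bar>\<^sup>2"
      unfolding key using pos(2) by simp
    then have "norm ?u * dist c (a + ?t *\<^sub>R ?u) = \<bar>cross2 ?u ?w\<bar>"
      by (rule power2_eq_imp_eq) simp_all
    then have "dist c (a + ?t *\<^sub>R ?u) = \<bar>cross2 ?u ?w\<bar> / norm ?u"
      using pos(1) by (simp add: field_simps)
    moreover have "infdist c (affine hull {a, b}) \<le> dist c (a + ?t *\<^sub>R ?u)"
      by (rule infdist_le) (unfold hull, rule rangeI)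
    ultimately show "infdist c (affine hull {a, b}) \<le> \<bar>cross2 ?u ?w\<bar> / norm ?u"
      by simp
  next
    have "\<bar>cross2 ?u ?w\<bar> / norm ?u \<le> dist c (a + t *\<^sub>R ?u)" for t
    proof -
      \<comment> \<open>Dropping the nonnegative second square in \<open>key\<close>.\<close>
      have "\<bar>cross2 ?u ?w\<bar> \<le> norm ?u * dist c (a + t *\<^sub>R ?u)"
        by (rule power2_le_imp_le) (simp_all add: key)
      then show ?thesis using pos(1) by (simp add: field_simps)
    qed
    then show "\<bar>cross2 ?u ?w\<bar> / norm ?u \<le> infdist c (affine hull {a, b})"
      unfolding hull infdist_def by (auto intro!: cINF_greatest)
  qed
  then show ?thesis using pos(1) by (simp add: dist_norm norm_minus_commute)
qed

text \<open>Reduces the indices \<open>i + 1\<close> and \<open>i + 2\<close> when \<open>i\<close>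
  is 2 or 3.\<close>

lemma numeral_mod_3 [simp]: "(4::3) = 1" "(5::3) = 2"
  by simp_all

lemma edge_length_mult_altitude_length:
  "edge_length T i * altitude_length T i = 2 * area T"
proof -
  have "{T (i + 1), T (i + 2), T i} = {T 1, T 2, T 3}"
    using exhaust_3[of i] by auto
  then show ?thesis
    unfolding edge_length_def altitude_length_def area_def triangle_hull_def
      dist_mult_infdist_affine_hull
    by (metis content_triangle_cross2)
qed

lemma
  assumes "area T > 0"
  shows edge_length_pos: "edge_length T i > 0"
    and altitude_length_eq: "altitude_length T i = 2 * area T / edge_length T i"
proof -
  have "edge_length T i \<noteq> 0"
    using edge_length_mult_altitude_length[of T i] assms by auto
  then show "edge_length T i > 0"
    by (simp add: edge_length_def)
  then show "altitude_length T i = 2 * area T / edge_length T i"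
    using edge_length_mult_altitude_length[of T i] by (simp add: field_simps)
qed

text \<open>For equal areas the altitude ratios are the inverses of the edge ratios, so \<open>m\<close> is the
  supremum distance of the logarithms of the edge lengths.\<close>
lemma m_le_iff:
  assumes "area T > 0" "area T' = area T"
  shows "m T T' \<le> c \<longleftrightarrow> (\<forall>i. \<bar>ln (edge_length T' i) - ln (edge_length T i)\<bar> \<le> c)"
proof -
  note pos = edge_length_pos[OF assms(1)] edge_length_pos[of T', unfolded assms(2), OF assms(1)]
  let ?r = "\<lambda>i. edge_length T' i / edge_length T i"
  let ?s = "\<lambda>i. altitude_length T' i / altitude_length T i"
  let ?R = "{?r 1, ?r 2, ?r 3, ?s 1, ?s 2, ?s 3}"
  have r: "?r i > 0" for i using pos by simp
  have s: "?s i = inverse (?r i)" for i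
    using pos(1)[THEN less_imp_neq, of i] pos(2)[THEN less_imp_neq, of i] assms
    by (auto simp: altitude_length_eq)
  have ln_r: "ln (?r i) = ln (edge_length T' i) - ln (edge_length T i)" for i
    by (rule ln_divide_pos) (rule pos)+
  have exp_iff: "x \<le> exp c \<longleftrightarrow> ln x \<le> c" if "x > 0" for x :: real
    using that by (metis exp_le_cancel_iff exp_ln)
  have Max_pos: "Max ?R > 0"
    using r[of 1] by (simp add: Max_gr_iff)
  have "m T T' \<le> c \<longleftrightarrow> Max ?R \<le> exp c"
    unfolding m_def using exp_iff[OF Max_pos] by simp
  also have "\<dots> \<longleftrightarrow> (\<forall>i. ?r i \<le> exp c \<and> ?s i \<le> exp c)"
    by (auto simp: forall_3)
  \<comment> \<open>Since \<open>?s i\<close> is the inverse of \<open>?r i\<close>, bounding it by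
    \<open>exp c\<close> amounts to \<open>- c \<le> ln (?r i)\<close>.\<close>
  also have "\<dots> \<longleftrightarrow> (\<forall>i. \<bar>ln (?r i)\<bar> \<le> c)"
    unfolding s using r by (simp add: exp_iff ln_inverse abs_le_iff del: inverse_divide)
  finally show ?thesis by (simp only: ln_r)
qed

lemma label_isometric_imp_edge_length_eq:
  assumes "label_isometric T T'"
  shows "edge_length T' = edge_length T"
proof
  fix i
  show "edge_length T' i = edge_length T i"
    using assms triangle_vertex_in_hull[of T] unfolding label_isometric_def edge_length_def by metis
qed

text \<open>Side-side-side congruence: the edge lengths fix the Gram matrix of the two edge vectors
  at vertex 1, and the affine map matching these vectors is then an isometry.\<close>

lemma edge_length_eq_imp_label_isometric:
  assumes "labeled_triangle T" and eq: "\<And>i. edge_length T' i = edge_length T i"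
  shows "label_isometric T T'"
proof -
  define u v u' v' where uv: "u = T 2 - T 1" "v = T 3 - T 1" "u' = T' 2 - T' 1" "v' = T' 3 - T' 1"
  have nz: "cross2 u v \<noteq> 0"
    using assms(1)
    by (simp add: labeled_triangle_def counterclockwise_def det_2 cross2_def uv algebra_simps)
  have norms: "norm u' = norm u" "norm v' = norm v" "norm (u' - v') = norm (u - v)"
    using eq[of 3] eq[of 2] eq[of 1]
    by (simp_all add: edge_length_def dist_norm uv norm_minus_commute)
  \<comment> \<open>Polarization recovers the mixed product from the third edge,
    \<open>u - v\<close>.\<close>
  then have inner: "u' \<bullet> u' = u \<bullet> u" "v' \<bullet> v' = v \<bullet> v" "u' \<bullet> v' = u \<bullet> v"
    by (simp_all add: norm_eq inner_simps inner_commute)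
  have norm_comb: "norm (a *\<^sub>R u' + b *\<^sub>R v') = norm (a *\<^sub>R u + b *\<^sub>R v)" for a b
    by (simp add: norm_eq inner_simps inner inner_commute[of v' u'] inner_commute[of v u])
  \<comment> \<open>By Cramer's rule the two quotients are the coordinates of \<open>x - T 1\<close>
    in the basis \<open>u\<close>, \<open>v\<close>; \<open>f\<close> transfers them to
    \<open>u'\<close>, \<open>v'\<close>.\<close>
  define f where "f = (\<lambda>x. T' 1 + (cross2 (x - T 1) v / cross2 u v) *\<^sub>R u'
                             + (cross2 u (x - T 1) / cross2 u v) *\<^sub>R v')"
  have f: "f (T 1 + a *\<^sub>R u + b *\<^sub>R v) = T' 1 + a *\<^sub>R u' + b *\<^sub>R v'" for a b
    using nz by (simp add: f_def add.assoc)
  let ?P = "{(a, b). 0 \<le> a \<and> 0 \<le> b \<and> a + b \<le> 1}"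
  have hull: "triangle_hull T = (\<lambda>(a, b). T 1 + a *\<^sub>R u + b *\<^sub>R v) ` ?P"
    "triangle_hull T' = (\<lambda>(a, b). T' 1 + a *\<^sub>R u' + b *\<^sub>R v') ` ?P"
    unfolding triangle_hull_def convex_hull_3_alt uv by auto
  have "dist (f (T 1 + a *\<^sub>R u + b *\<^sub>R v)) (f (T 1 + c *\<^sub>R u + d *\<^sub>R v))
      = dist (T 1 + a *\<^sub>R u + b *\<^sub>R v) (T 1 + c *\<^sub>R u + d *\<^sub>R v)" for a b c d
    using norm_comb[of "a - c" "b - d"] unfolding f dist_norm by (simp add: algebra_simps)
  then have "\<forall>x\<in>triangle_hull T. \<forall>y\<in>triangle_hull T. dist (f x) (f y) = dist x y"
    unfolding hull by auto
  moreover have "f ` triangle_hull T = triangle_hull T'"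
    unfolding hull image_image by (simp add: f case_prod_unfold)
  moreover have "f (T i) = T' i" for i
    using f[of 0 0] f[of 1 0] f[of 0 1] exhaust_3[of i] by (auto simp: uv)
  ultimately show ?thesis
    unfolding label_isometric_def by blast
qed

text \<open>Well-definedness on classes: changing representatives preserves edge lengths, and for
  equal areas these determine \<open>m\<close>. Hence the image in \<open>m_class_def\<close> is a
  singleton.\<close>

lemma m_class_eq:
  assumes "A > 0" and X: "X \<in> triangle_space A" "T \<in> X" and Y: "Y \<in> triangle_space A" "T' \<in> Y"
  shows "m_class X Y = m T T'"
proof -
  have area: "area S = A" if "S \<in> X \<union> Y" for S
    using that X(1) Y(1) in_quotient_imp_subset[OF equiv_triangle_equiv]
    unfolding triangle_space_def triangles_of_area_def by blast
  have edges: "edge_length S' = edge_length S"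
    if "S \<in> Z" "S' \<in> Z" "Z \<in> triangle_space A" for S S' Z
    using quotient_eq_iff[OF equiv_triangle_equiv that(3)[unfolded triangle_space_def]
        that(3)[unfolded triangle_space_def] that(1,2)]
    by (auto simp: triangle_equiv_def intro: label_isometric_imp_edge_length_eq)
  have "m S S' = m T T'" if "S \<in> X" "S' \<in> Y" for S S'
  proof -
    \<comment> \<open>Two reals with the same upper bounds are equal; this suits
      \<open>m_le_iff\<close>, which describes \<open>m\<close> through its upper bounds. The same
      device later gives \<open>m T T = 0\<close> and symmetry.\<close>
    have "m S S' \<le> c \<longleftrightarrow> m T T' \<le> c" for c
      using that X Y assms(1) edges[OF X(2) that(1) X(1)] edges[OF Y(2) that(2) Y(1)]
      by (simp add: m_le_iff area)
    then show ?thesis by (metis order_antisym order_refl)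
  qed
  then have "(\<lambda>(T, T'). m T T') ` (X \<times> Y) = (\<lambda>_. m T T') ` (X \<times> Y)"
    by (intro image_cong) auto
  also have "\<dots> = {m T T'}"
    using X(2) Y(2) by (auto simp: image_constant_conv)
  finally show ?thesis by (simp add: m_class_def)
qed

theorem theorem3:
  fixes A :: real
  assumes "A > 0"
  shows "metric_on (triangle_space A) m_class \<and> symmetric_on (triangle_space A) m_class"
proof -
  let ?S = "triangle_space A"
  have rep: "\<exists>T. T \<in> X \<and> labeled_triangle T \<and> area T = A" if "X \<in> ?S" for X
  proof -
    from that have "X \<noteq> {}" "X \<subseteq> triangles_of_area A"
      unfolding triangle_space_def
      using in_quotient_imp_non_empty in_quotient_imp_subset equiv_triangle_equiv by blast+
    then show ?thesis by (auto simp: triangles_of_area_def)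
  qed
  note m_class = m_class_eq[OF assms]
  have zero: "m_class X X = 0" if X: "X \<in> ?S" for X
  proof -
    obtain T where T: "T \<in> X" "area T = A" using rep[OF X] by blast
    have "m T T \<le> c \<longleftrightarrow> 0 \<le> c" for c using assms T by (simp add: m_le_iff)
    then have "m T T = 0" by (metis order_antisym order_refl)
    with T X show ?thesis by (simp add: m_class)
  qed
  have pos: "m_class X Y > 0" if XY: "X \<in> ?S" "Y \<in> ?S" "X \<noteq> Y" for X Y
  proof (rule ccontr)
    obtain T where T: "T \<in> X" "labeled_triangle T" "area T = A" using rep XY by blast
    obtain T' where T': "T' \<in> Y" "labeled_triangle T'" "area T' = A" using rep XY by blast
    assume "\<not> m_class X Y > 0"
    then have "m T T' \<le> 0" using m_class XY T T' by simp
    \<comment> \<open>A bound of 0 on each absolute difference forces equality, so side-side-side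
      congruence puts both representatives in one class.\<close>
    then have "ln (edge_length T' i) = ln (edge_length T i)" for i
      using assms T T' by (simp add: m_le_iff)
    then have "edge_length T' i = edge_length T i" for i
      using edge_length_pos[of T i] edge_length_pos[of T' i] assms T T' by (metis ln_inj_iff)
    then have "(T, T') \<in> triangle_equiv A"
      using edge_length_eq_imp_label_isometric T T'
      by (auto simp: triangle_equiv_def triangles_of_area_def)
    then have "X = Y"
      using quotient_eq_iff[OF equiv_triangle_equiv] XY T(1) T'(1)
      unfolding triangle_space_def by metis
    with XY show False by simp
  qed
  have triangle: "m_class X Z \<le> m_class X Y + m_class Y Z"
    if S: "X \<in> ?S" "Y \<in> ?S" "Z \<in> ?S" for X Y Z
  proof -
    obtain T where T: "T \<in> X" "area T = A" using rep S by blast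
    obtain T' where T': "T' \<in> Y" "area T' = A" using rep S by blast
    obtain T'' where T'': "T'' \<in> Z" "area T'' = A" using rep S by blast
    let ?l = "\<lambda>T i. ln (edge_length T i)"
    have "\<bar>?l T'' i - ?l T i\<bar> \<le> m T T' + m T' T''" for i
    proof -
      have "\<bar>?l T' i - ?l T i\<bar> \<le> m T T'"
        using m_le_iff[of T T' "m T T'"] assms T T' by simp
      moreover have "\<bar>?l T'' i - ?l T' i\<bar> \<le> m T' T''"
        using m_le_iff[of T' T'' "m T' T''"] assms T' T'' by simp
      ultimately show ?thesis by linarith
    qed
    then have "m T T'' \<le> m T T' + m T' T''" using assms T T'' by (simp add: m_le_iff)
    then show ?thesis using S T T' T'' by (simp add: m_class)
  qed
  have sym: "m_class X Y = m_class Y X" if S: "X \<in> ?S" "Y \<in> ?S" for X Y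
  proof -
    obtain T where T: "T \<in> X" "area T = A" using rep S by blast
    obtain T' where T': "T' \<in> Y" "area T' = A" using rep S by blast
    have "m T T' \<le> c \<longleftrightarrow> m T' T \<le> c" for c
      using assms T T' by (simp add: m_le_iff abs_minus_commute)
    then have "m T T' = m T' T" by (metis order_antisym order_refl)
    then show ?thesis using S T T' by (simp add: m_class)
  qed
  show ?thesis
    unfolding metric_on_def symmetric_on_def using zero pos triangle sym by blast
qed

end
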